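(* Let $G$ be a cubic graph with base embedding $\widehat{\Pi}$, and let $\Pi$ be an embedding of $G$ with $\Pi$-unstable dual $G^*_\Pi$. Suppose that $G^*_\Pi$ is the disjoint union of two graphs $H_1$ and $H_2$, each of which is zero-homologous. Then there exist embeddings $\Pi_1$ and $\Pi_2$ of $G$ such that $G^*_{\Pi_1}=H_1$ and $G^*_{\Pi_2}=H_2$. Furthermore, $\Delta g(\Pi)=\Delta g(\Pi_1)+\Delta g(\Pi_2)$.
   Context: $G$ is a finite connected graph. All embeddings are 2-cell embeddings in closed orientable surfaces and are described by rotation systems: an embedding $\Pi$ assigns to each vertex $v$ a clockwise cyclic ordering $\pi_v$ of the edges incident with $v$. $g(\Pi)$ is the genus of the surface of $\Pi$. Fix a base embedding $\widehat{\Pi}$ with local rotations $\widehat{\pi}_v$. A vertex $v$ is $\Pi$-unstable if $\pi_v\neq\widehat{\pi}_v$; an edge is $\Pi$-unstable if exactly one of its endpoints is $\Pi$-unstable; a face of $\widehat{\Pi}$ is $\Pi$-unstable if its boundary contains at least one $\Pi$-unstable edge. Let $G^*$ be the dual graph of $G$ with respect to $\widehat{\Pi}$, embedded in the same surface as $\widehat{\Pi}$ (it may have loops and parallel edges). The $\Pi$-unstable dual $G^*_\Pi$ is the subgraph of $G^*$ whose vertices are the $\Pi$-unstable faces and whose edges are the dual edges of the $\Pi$-unstable edges. A subgraph $H^*$ of $G^*$ is zero-homologous if its edges separate the surface into two parts $A\cup B$ with $\partial A=\partial B=E(H^* )$; equivalently, $E(H^* )$ is the mod-2 sum of the boundaries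 of some set of faces of $G^*$. $\Delta g(\Pi)=g(\Pi)-g(\widehat{\Pi})$. *)

theory Defs
  imports "Graph_Theory.Graph_Theory" "HOL-Combinatorics.Orbits"
begin

text \<open>
  Graphs are bidirected digraphs: an undirected edge is a pair \<open>{a, arev a}\<close> of opposite arcs,
  and the arcs leaving a vertex \<open>v\<close> are the ends of edges at \<open>v\<close>. Parallel edges are distinct pairs,
  and a loop at \<open>v\<close> contributes both of its arcs to \<open>out_arcs G v\<close>, so that \<open>out_degree G v\<close> is the
  degree of \<open>v\<close> as an undirected multigraph.
\<close>

definition edges :: "('v, 'e) pre_digraph \<Rightarrow> ('e \<Rightarrow> 'e) \<Rightarrow> 'e set set" where
  "edges G arev = (\<lambda>a. {a, arev a}) ` arcs G"

definition cubic :: "('v, 'e) pre_digraph \<Rightarrow> bool" where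
  "cubic G \<longleftrightarrow> (\<forall>v \<in> verts G. out_degree G v = 3)"

text \<open>
  An embedding is a rotation system, given by its clockwise successor function \<open>\<pi>\<close>: the local
  rotation at \<open>v\<close> is the restriction of \<open>\<pi>\<close> to \<open>out_arcs G v\<close>.
\<close>

definition embedding :: "('v, 'e) pre_digraph \<Rightarrow> ('e \<Rightarrow> 'e) \<Rightarrow> bool" where
  "embedding G \<pi> \<longleftrightarrow> \<pi> permutes arcs G \<and>
     (\<forall>v \<in> verts G. out_arcs G v \<noteq> {} \<longrightarrow> cyclic_on \<pi> (out_arcs G v))"

text \<open>
  Face tracing: after traversing \<open>a\<close>, continue with the successor of \<open>arev a\<close> in the rotation at the
  head of \<open>a\<close>. A face is identified with the set of arcs on its boundary walk, each traversed in the
  direction given by the walk; its boundary contains the edge \<open>{a, arev a}\<close> iff it contains \<open>a\<close> or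
  \<open>arev a\<close>.
\<close>

definition face_succ :: "('e \<Rightarrow> 'e) \<Rightarrow> ('e \<Rightarrow> 'e) \<Rightarrow> 'e \<Rightarrow> 'e" where
  "face_succ arev \<pi> = \<pi> \<circ> arev"

definition face_of :: "('e \<Rightarrow> 'e) \<Rightarrow> ('e \<Rightarrow> 'e) \<Rightarrow> 'e \<Rightarrow> 'e set" where
  "face_of arev \<pi> a = orbit (face_succ arev \<pi>) a"

definition faces :: "('v, 'e) pre_digraph \<Rightarrow> ('e \<Rightarrow> 'e) \<Rightarrow> ('e \<Rightarrow> 'e) \<Rightarrow> 'e set set" where
  "faces G arev \<pi> = face_of arev \<pi> ` arcs G"

text \<open>
  The genus \<open>g\<close> of a connected surface is determined by Euler's formula \<open>V - E + F = 2 - 2 g\<close>.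
  It is taken as a rational number so that no rounding is involved. (The formula would miss the
  single face of the one-vertex graph without edges, which is not cubic.)
\<close>

definition genus :: "('v, 'e) pre_digraph \<Rightarrow> ('e \<Rightarrow> 'e) \<Rightarrow> ('e \<Rightarrow> 'e) \<Rightarrow> rat" where
  "genus G arev \<pi> =
     (2 - (of_nat (card (verts G)) - of_nat (card (edges G arev)) + of_nat (card (faces G arev \<pi>)))) / 2"

definition delta_genus ::
  "('v, 'e) pre_digraph \<Rightarrow> ('e \<Rightarrow> 'e) \<Rightarrow> ('e \<Rightarrow> 'e) \<Rightarrow> ('e \<Rightarrow> 'e) \<Rightarrow> rat" where
  "delta_genus G arev \<pi>0 \<pi> = genus G arev \<pi> - genus G arev \<pi>0"

text \<open>In the following, \<open>\<pi>0\<close> is the base embedding.\<close>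

definition unstable_vertex :: "('v, 'e) pre_digraph \<Rightarrow> ('e \<Rightarrow> 'e) \<Rightarrow> ('e \<Rightarrow> 'e) \<Rightarrow> 'v \<Rightarrow> bool" where
  "unstable_vertex G \<pi>0 \<pi> v \<longleftrightarrow> v \<in> verts G \<and> (\<exists>a \<in> out_arcs G v. \<pi> a \<noteq> \<pi>0 a)"

definition unstable_arcs :: "('v, 'e) pre_digraph \<Rightarrow> ('e \<Rightarrow> 'e) \<Rightarrow> ('e \<Rightarrow> 'e) \<Rightarrow> 'e set" where
  "unstable_arcs G \<pi>0 \<pi> =
     {a \<in> arcs G. unstable_vertex G \<pi>0 \<pi> (tail G a) \<noteq> unstable_vertex G \<pi>0 \<pi> (head G a)}"

definition unstable_faces ::
  "('v, 'e) pre_digraph \<Rightarrow> ('e \<Rightarrow> 'e) \<Rightarrow> ('e \<Rightarrow> 'e) \<Rightarrow> ('e \<Rightarrow> 'e) \<Rightarrow> 'e set set" where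
  "unstable_faces G arev \<pi>0 \<pi> = {f \<in> faces G arev \<pi>0. f \<inter> unstable_arcs G \<pi>0 \<pi> \<noteq> {}}"

text \<open>
  The dual edge of \<open>{a, arev a}\<close> is represented by the same pair of arcs, joining the faces on the two
  sides. The rotation at a dual vertex is the boundary walk of that face, so the dual graph is embedded
  in the same surface by \<open>face_succ arev \<pi>\<close>.
\<close>

definition dual :: "('v, 'e) pre_digraph \<Rightarrow> ('e \<Rightarrow> 'e) \<Rightarrow> ('e \<Rightarrow> 'e) \<Rightarrow> ('e set, 'e) pre_digraph" where
  "dual G arev \<pi> =
     \<lparr>verts = faces G arev \<pi>, arcs = arcs G,
      tail = face_of arev \<pi>, head = (\<lambda>a. face_of arev \<pi> (arev a))\<rparr>"

definition unstable_dual ::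
  "('v, 'e) pre_digraph \<Rightarrow> ('e \<Rightarrow> 'e) \<Rightarrow> ('e \<Rightarrow> 'e) \<Rightarrow> ('e \<Rightarrow> 'e) \<Rightarrow> ('e set, 'e) pre_digraph" where
  "unstable_dual G arev \<pi>0 \<pi> =
     \<lparr>verts = unstable_faces G arev \<pi>0 \<pi>, arcs = unstable_arcs G \<pi>0 \<pi>,
      tail = tail (dual G arev \<pi>0), head = head (dual G arev \<pi>0)\<rparr>"

text \<open>
  Boundaries are taken modulo 2: an edge with the same face on both sides is not in the boundary of
  that face.
\<close>

definition face_boundary :: "('v, 'e) pre_digraph \<Rightarrow> ('e \<Rightarrow> 'e) \<Rightarrow> 'e set \<Rightarrow> 'e set" where
  "face_boundary G arev f = {a \<in> arcs G. (a \<in> f) \<noteq> (arev a \<in> f)}"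

definition boundary_sum :: "('v, 'e) pre_digraph \<Rightarrow> ('e \<Rightarrow> 'e) \<Rightarrow> 'e set set \<Rightarrow> 'e set" where
  "boundary_sum G arev F = {a \<in> arcs G. odd (card {f \<in> F. a \<in> face_boundary G arev f})}"

definition zero_homologous ::
  "('v, 'e) pre_digraph \<Rightarrow> ('e \<Rightarrow> 'e) \<Rightarrow> ('e \<Rightarrow> 'e) \<Rightarrow> ('v, 'e) pre_digraph \<Rightarrow> bool" where
  "zero_homologous G arev \<pi> H \<longleftrightarrow>
     subgraph H G \<and> (\<exists>F \<subseteq> faces G arev \<pi>. arcs H = boundary_sum G arev F)"

definition disjoint_union_of ::
  "('v, 'e) pre_digraph \<Rightarrow> ('v, 'e) pre_digraph \<Rightarrow> ('v, 'e) pre_digraph \<Rightarrow> bool" where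
  "disjoint_union_of G H1 H2 \<longleftrightarrow>
     subgraph H1 G \<and> subgraph H2 G \<and> verts H1 \<inter> verts H2 = {} \<and> G = union H1 H2"

end

theory Submission
  imports Defs
begin

text \<open>
  A vertex of degree 3 has only two rotations, so an embedding amounts to a set of vertices at which
  the base rotation is reversed. Record a side of an edge as an arc together with a sense of rotation.
  Tracing faces on these flags, each face is met once in either direction. Reversing the sense at
  the unstable vertices turns the tracing into that of the base embedding, except that the sense is
  swapped along each unstable edge. Hence the number of faces depends only on the unstable edges, and
  the tracing differs from the one of the base embedding only inside the unstable base faces. As
  \<open>H\<^sub>1\<close> and \<open>H\<^sub>2\<close> have no base face in common, their effects on the number of faces add up.
\<close>

section \<open>Orbits\<close>

lemma orbit_image_semiconj:
  assumes "f ` A \<subseteq> A" and "\<And>y. y \<in> A \<Longrightarrow> h (f y) = g (h y)" and "x \<in> A"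
  shows "orbit g (h x) = h ` orbit f x"
proof -
  have "(f ^^ n) x \<in> A \<and> (g ^^ n) (h x) = h ((f ^^ n) x)" for n
    by (induction n) (use assms in auto)
  then show ?thesis by (auto simp: orbit_altdef)
qed

lemma orbit_subset_invariant:
  assumes "f ` A \<subseteq> A" and "x \<in> A"
  shows "orbit f x \<subseteq> A"
proof
  fix y assume "y \<in> orbit f x"
  then show "y \<in> A" by induct (use assms in auto)
qed

text \<open>An injective \<open>h\<close> has an injective image map on subsets of \<open>A\<close>,
  so distinct orbits keep distinct images.\<close>

lemma card_orbits_semiconj:
  assumes "f ` A \<subseteq> A" and "\<And>y. y \<in> A \<Longrightarrow> h (f y) = g (h y)" and "inj_on h A"
  shows "card (orbit g ` h ` A) = card (orbit f ` A)"
proof -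
  have "orbit g ` h ` A = (`) h ` orbit f ` A"
    unfolding image_image using orbit_image_semiconj[of f A h g] assms(1,2) by (intro image_cong) auto
  moreover have "inj_on ((`) h) (orbit f ` A)"
    by (rule inj_on_subset[OF inj_on_image_Pow[OF assms(3)]])
       (use orbit_subset_invariant[OF assms(1)] in auto)
  ultimately show ?thesis by (simp add: card_image)
qed

lemma card_orbits_split:
  assumes "finite A" and "X \<subseteq> A" and "f ` X \<subseteq> X" and "f ` (A - X) \<subseteq> A - X"
  shows "card (orbit f ` A) = card (orbit f ` X) + card (orbit f ` (A - X))"
proof -
  have "orbit f ` X \<inter> orbit f ` (A - X) = {}"
  proof (rule ccontr)
    assume "\<not> ?thesis"
    then obtain x y where xy: "x \<in> X" "y \<in> A - X" "orbit f x = orbit f y" by auto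
    \<comment> \<open>\<open>orbit f x\<close> starts at \<open>f x\<close> and need not contain
      \<open>x\<close> itself, so \<open>f x\<close> serves as the common point.\<close>
    have "f x \<in> orbit f x" by (rule orbit.base)
    moreover have "orbit f y \<subseteq> A - X" using assms(4) xy(2) by (rule orbit_subset_invariant)
    ultimately show False using xy assms(3) by auto
  qed
  moreover have "orbit f ` A = orbit f ` X \<union> orbit f ` (A - X)" using assms(2) by auto
  ultimately show ?thesis
    using assms(1,2) by (simp add: card_Un_disjoint finite_subset)
qed

lemma orbits_cong:
  assumes "f ` A \<subseteq> A" and "\<And>y. y \<in> A \<Longrightarrow> f y = g y"
  shows "orbit f ` A = orbit g ` A"
proof (rule image_cong)
  fix x assume "x \<in> A"
  then show "orbit f x = orbit g x" by (rule orbit_cong0) (use assms in auto)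
qed simp

section \<open>Cyclic permutations of a three-element set\<close>

lemma cyclic_on_card_3:
  assumes "cyclic_on f S" and "card S = 3" and "x \<in> S"
  shows "S = {x, f x, f (f x)}" and "f (f (f x)) = x"
    and "f x \<noteq> x" and "f (f x) \<noteq> x" and "f (f x) \<noteq> f x"
proof -
  have S: "orbit f x = S" using assms(1,3) by (rule orbit_cyclic_eq3)
  then have x: "x \<in> orbit f x" using assms(3) by simp
  \<comment> \<open>The iterates of \<open>x\<close> before its first return list the orbit without
    repetition, so the first return time is 3.\<close>
  have "card S = funpow_dist1 f x x"
    using card_image[OF inj_on_funpow_dist1[OF x]] orbit_conv_funpow_dist1[OF x] S by simp
  then have n: "funpow_dist1 f x x = 3" using assms(2) by simp
  show "f (f (f x)) = x"
    using funpow_dist1_prop[OF x] unfolding n by (simp add: numeral_3_eq_3)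
  have "{0..<3::nat} = {0, 1, 2}" by auto
  then show S3: "S = {x, f x, f (f x)}"
    using orbit_conv_funpow_dist1[OF x] S unfolding n by (auto simp: numeral_2_eq_2)
  show "f x \<noteq> x" "f (f x) \<noteq> x" "f (f x) \<noteq> f x"
    using assms(2) unfolding S3 by (auto simp: card_insert_if split: if_splits)
qed

lemma inv_eq_cyclic_on_card_3:
  assumes "bij f" and "cyclic_on f S" and "card S = 3" and "x \<in> S"
  shows "inv f x = f (f x)"
  by (rule inv_f_eq[OF bij_is_inj[OF assms(1)]]) (rule cyclic_on_card_3(2)[OF assms(2-)])

text \<open>Three elements carry only two cyclic permutations, \<open>f\<close> and its square.
  Disagreement with \<open>f\<close> at one point therefore fixes \<open>g\<close>
  everywhere.\<close>

lemma cyclic_on_card_3_neq: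
  assumes f: "cyclic_on f S" and g: "cyclic_on g S" and S: "card S = 3"
    and x: "x \<in> S" "g x \<noteq> f x" and y: "y \<in> S"
  shows "g y = f (f y)"
proof -
  note F = cyclic_on_card_3[OF f S x(1)] and G = cyclic_on_card_3[OF g S x(1)]
  have "g x \<in> S" "g (g x) \<in> S" using g x by (auto intro: cyclic_on_inI)
  then have "g x = f (f x)" "g (f (f x)) = f x" "g (f x) = x"
    using F G x(2) by (metis empty_iff insert_iff)+
  then show ?thesis using y F(1,2) by auto
qed

section \<open>Face tracing on flags\<close>

text \<open>This is face traversal for a signed rotation system in which \<open>D\<close> is the set
  of edges of negative signature. The sense \<open>s\<close> refers to the tail of \<open>a\<close>;
  it is updated first, and \<open>s'\<close> then decides how to turn at the head.\<close>

definition twisted_succ :: "('e \<Rightarrow> 'e) \<Rightarrow> ('e \<Rightarrow> 'e) \<Rightarrow> 'e set \<Rightarrow> 'e \<times> bool \<Rightarrow> 'e \<times> bool" where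
  "twisted_succ arev \<pi> D =
     (\<lambda>(a, s). let s' = (s \<noteq> (a \<in> D)) in ((if s' then \<pi> else inv \<pi>) (arev a), s'))"

text \<open>The base face on whose side of the edge the flag lies: with \<open>s\<close> false the
  walk runs backwards along the face of \<open>arev a\<close>.\<close>

definition flag_face :: "('e \<Rightarrow> 'e) \<Rightarrow> ('e \<Rightarrow> 'e) \<Rightarrow> 'e \<times> bool \<Rightarrow> 'e set" where
  "flag_face arev \<pi> = (\<lambda>(a, s). face_of arev \<pi> (if s then a else arev a))"

definition edge_cut :: "('v, 'e) pre_digraph \<Rightarrow> 'v set \<Rightarrow> 'e set" where
  "edge_cut G S = {a \<in> arcs G. (tail G a \<in> S) \<noteq> (head G a \<in> S)}"

locale embedded_digraph = bidirected_digraph G arev + fin_digraph G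
  for G :: "('v, 'e) pre_digraph" and arev :: "'e \<Rightarrow> 'e" +
  fixes \<pi> :: "'e \<Rightarrow> 'e"
  assumes embedding: "embedding G \<pi>"
begin

abbreviation flags :: "('e \<times> bool) set" where
  "flags \<equiv> arcs G \<times> UNIV"

lemma permutes: "\<pi> permutes arcs G"
  using embedding by (simp add: embedding_def)

lemma bij: "bij \<pi>"
  using permutes by (rule permutes_bij)

lemma inv_permutes: "inv \<pi> permutes arcs G"
  using permutes by (rule permutes_inv)

lemma in_arcs [simp]: "\<pi> a \<in> arcs G \<longleftrightarrow> a \<in> arcs G" "inv \<pi> a \<in> arcs G \<longleftrightarrow> a \<in> arcs G"
  using permutes inv_permutes by (simp_all add: permutes_in_image)

lemma inv_apply [simp]: "inv \<pi> (\<pi> a) = a" "\<pi> (inv \<pi> a) = a"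
  using permutes by (simp_all add: permutes_inverses)

lemma permutation: "permutation \<pi>"
  using permutes finite_arcs unfolding permutation_permutes by blast

lemma cyclic_on_out_arcs:
  assumes "a \<in> arcs G"
  shows "cyclic_on \<pi> (out_arcs G (tail G a))"
proof -
  have "a \<in> out_arcs G (tail G a)" using assms by simp
  then show ?thesis using embedding assms tail_in_verts unfolding embedding_def by blast
qed

lemma tail_apply [simp]:
  assumes "a \<in> arcs G"
  shows "tail G (\<pi> a) = tail G a"
  using cyclic_on_inI[OF cyclic_on_out_arcs[OF assms], of a] assms by simp

lemma tail_inv_apply [simp]:
  assumes "a \<in> arcs G"
  shows "tail G (inv \<pi> a) = tail G a"
  using tail_apply[of "inv \<pi> a"] assms by simp

lemma permutes_face_succ: "face_succ arev \<pi> permutes arcs G"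
  unfolding face_succ_def using arev_permutes_arcs permutes by (rule permutes_compose)

lemma permutation_face_succ: "permutation (face_succ arev \<pi>)"
  using permutes_face_succ finite_arcs unfolding permutation_permutes by blast

lemma inv_face_succ: "inv (face_succ arev \<pi>) = arev \<circ> inv \<pi>"
  unfolding face_succ_def
  by (rule inv_unique_comp) (auto simp: fun_eq_iff)

lemma face_of_face_succ: "face_of arev \<pi> (\<pi> (arev a)) = face_of arev \<pi> a"
  using permutation_orbit_step[OF permutation_face_succ, of a]
  by (simp add: face_of_def face_succ_def)

lemma self_in_face_of: "a \<in> face_of arev \<pi> a"
  unfolding face_of_def by (rule permutation_self_in_orbit[OF permutation_face_succ])

text \<open>Crossing a twisted edge changes to its other side; the turn at the head then stays on
  the boundary of that face. A step can thus leave a base face only through an edge in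
  \<open>D\<close>.\<close>

lemma flag_face_twisted_succ:
  "flag_face arev \<pi> (twisted_succ arev \<pi> D (a, s)) = flag_face arev \<pi> (a, s \<noteq> (a \<in> D))"
proof -
  have "face_of arev \<pi> (arev (inv \<pi> (arev a))) = face_of arev \<pi> (arev a)"
    using face_of_face_succ[of "arev (inv \<pi> (arev a))"] by simp
  then show ?thesis
    by (simp add: flag_face_def twisted_succ_def face_of_face_succ)
qed

lemma twisted_succ_flags: "twisted_succ arev \<pi> D ` flags \<subseteq> flags"
  by (auto simp: twisted_succ_def Let_def)

text \<open>Without twists the sense is constant along an orbit, so each face gives exactly two
  orbits, one for each direction of its walk.\<close>

lemma card_orbits_untwisted:
  "card (orbit (twisted_succ arev \<pi> {}) ` flags) = 2 * card (faces G arev \<pi>)"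
proof -
  let ?f = "twisted_succ arev \<pi> {}"
  let ?p = "\<lambda>a. (a, True)" and ?m = "\<lambda>a. (arev a, False)"
  have p: "orbit ?f (a, True) = ?p ` face_of arev \<pi> a" for a
    unfolding face_of_def
    by (rule orbit_image_semiconj[where A = UNIV]) (auto simp: twisted_succ_def face_succ_def)
  \<comment> \<open>A permutation of finite support and its inverse have the same orbits; flags with
    sense \<open>False\<close> follow the inverse.\<close>
  have m: "orbit ?f (arev a, False) = ?m ` face_of arev \<pi> a" for a
    unfolding face_of_def orbit_inv_eq[OF permutation_face_succ, symmetric]
    by (rule orbit_image_semiconj[where A = UNIV]) (auto simp: twisted_succ_def inv_face_succ)
  have "flags = ?p ` arcs G \<union> ?m ` arcs G"
    by (auto simp: image_iff) (metis arev_arev arev_in_arcs)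
  then have eq: "orbit ?f ` flags = (`) ?p ` faces G arev \<pi> \<union> (`) ?m ` faces G arev \<pi>"
    by (simp add: image_Un image_image p m faces_def)
  have "(`) ?p ` faces G arev \<pi> \<inter> (`) ?m ` faces G arev \<pi> = {}"
  proof (rule ccontr)
    assume "\<not> ?thesis"
    then obtain a b where "?p ` face_of arev \<pi> a = ?m ` face_of arev \<pi> b" by (auto simp: faces_def)
    with self_in_face_of[of a] show False by blast
  qed
  moreover have "inj ?p" "inj ?m" by (auto simp: inj_on_def arev_eq_iff)
  then have "inj ((`) ?p)" "inj ((`) ?m)" 
    using inj_on_image[of ?p UNIV] inj_on_image[of ?m UNIV] by simp_all
  then have "card ((`) ?p ` faces G arev \<pi>) = card (faces G arev \<pi>)"
    "card ((`) ?m ` faces G arev \<pi>) = card (faces G arev \<pi>)"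
    by (auto intro: card_image inj_on_subset)
  moreover have "finite (faces G arev \<pi>)" by (simp add: faces_def)
  ultimately show ?thesis unfolding eq by (subst card_Un_disjoint) auto
qed

text \<open>The flags on faces in \<open>V\<close> are invariant under all four tracings. On them
  \<open>D\<close> acts as \<open>D1\<close>, and \<open>D2\<close> as the empty set; on the other
  flags the roles of \<open>D1\<close> and \<open>D2\<close> are exchanged. Counting orbits on both
  parts gives the identity.\<close>

lemma card_orbits_twisted_additive:
  assumes D: "D = D1 \<union> D2"
    and D1: "\<And>a. a \<in> D1 \<Longrightarrow> face_of arev \<pi> a \<in> V \<and> face_of arev \<pi> (arev a) \<in> V"
    and D2: "\<And>a. a \<in> D2 \<Longrightarrow> face_of arev \<pi> a \<notin> V \<and> face_of arev \<pi> (arev a) \<notin> V"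
  shows "card (orbit (twisted_succ arev \<pi> D) ` flags) + card (orbit (twisted_succ arev \<pi> {}) ` flags) =
    card (orbit (twisted_succ arev \<pi> D1) ` flags) + card (orbit (twisted_succ arev \<pi> D2) ` flags)"
proof -
  let ?f = "twisted_succ arev \<pi>"
  define X where "X = {x \<in> flags. flag_face arev \<pi> x \<in> V}"
  have step: "?f E x \<in> X \<longleftrightarrow> x \<in> X" if "E \<subseteq> D" "x \<in> flags" for E x
  proof (cases x)
    case (Pair a s)
    \<comment> \<open>A twist swaps the two sides of an edge, but for edges in \<open>D\<close> both
      sides are in \<open>V\<close> or both are outside.\<close>
    have "flag_face arev \<pi> (a, s \<noteq> (a \<in> E)) \<in> V \<longleftrightarrow> flag_face arev \<pi> (a, s) \<in> V"
      using that(1) D D1[of a] D2[of a] by (auto simp: flag_face_def)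
    moreover have "?f E (a, s) \<in> flags" using twisted_succ_flags that(2) Pair by blast
    ultimately show ?thesis
      using that(2) Pair by (simp add: X_def flag_face_twisted_succ)
  qed
  have X: "?f E ` X \<subseteq> X" "?f E ` (flags - X) \<subseteq> flags - X" if "E \<subseteq> D" for E
  proof -
    have "X \<subseteq> flags" by (auto simp: X_def)
    then show "?f E ` X \<subseteq> X" "?f E ` (flags - X) \<subseteq> flags - X"
      using step[OF that] twisted_succ_flags[of E] by blast+
  qed
  have split: "card (orbit (?f E) ` flags) =
      card (orbit (?f E) ` X) + card (orbit (?f E) ` (flags - X))" if "E \<subseteq> D" for E
    by (rule card_orbits_split) (use X[OF that] in \<open>auto simp: X_def\<close>)
  have sub: "D1 \<subseteq> D" "D2 \<subseteq> D" using D by auto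
  have inside: "a \<notin> D2" if "(a, s) \<in> X" for a s
    using that D2[of a] by (auto simp: X_def flag_face_def split: if_splits)
  have outside: "a \<notin> D1" if "(a, s) \<in> flags - X" for a s
    using that D1[of a] by (auto simp: X_def flag_face_def split: if_splits)
  have "orbit (?f D) ` X = orbit (?f D1) ` X"
    by (rule orbits_cong[OF X(1)]) (use D inside in \<open>auto simp: twisted_succ_def\<close>)
  moreover have "orbit (?f D2) ` X = orbit (?f {}) ` X"
    by (rule orbits_cong[OF X(1)]) (use sub inside in \<open>auto simp: twisted_succ_def\<close>)
  moreover have "orbit (?f D) ` (flags - X) = orbit (?f D2) ` (flags - X)"
    by (rule orbits_cong[OF X(2)]) (use D outside in \<open>auto simp: twisted_succ_def\<close>)
  moreover have "orbit (?f D1) ` (flags - X) = orbit (?f {}) ` (flags - X)"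
    by (rule orbits_cong[OF X(2)]) (use sub outside in \<open>auto simp: twisted_succ_def\<close>)
  ultimately show ?thesis using split[of D] split[of "{}"] split[OF sub(1)] split[OF sub(2)] by simp
qed

section \<open>Reversing rotations\<close>

text \<open>A relation rather than a construction, so that it covers both the given embedding and
  those built from a vertex set.\<close>

definition reversal :: "'v set \<Rightarrow> ('e \<Rightarrow> 'e) \<Rightarrow> bool" where
  "reversal S \<rho> \<longleftrightarrow> embedding G \<rho> \<and>
     (\<forall>a \<in> arcs G. \<rho> a = (if tail G a \<in> S then inv \<pi> a else \<pi> a))"

text \<open>Reversing orientation locally at the vertices in \<open>S\<close> turns
  \<open>\<rho>\<close> back into \<open>\<pi>\<close>, at the price of a twist on each edge with
  exactly one end in \<open>S\<close>.\<close>

lemma card_orbits_reversal: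
  assumes "reversal S \<rho>"
  shows "card (orbit (twisted_succ arev \<pi> (edge_cut G S)) ` flags) = 2 * card (faces G arev \<rho>)"
proof -
  interpret R: embedded_digraph G arev \<rho>
    by unfold_locales (use assms in \<open>simp add: reversal_def\<close>)
  have \<rho>: "\<rho> a = (if tail G a \<in> S then inv \<pi> a else \<pi> a)" if "a \<in> arcs G" for a
    using assms that by (simp add: reversal_def)
  have inv_\<rho>: "inv \<rho> a = (if tail G a \<in> S then \<pi> a else inv \<pi> a)" if "a \<in> arcs G" for a
    by (rule inv_f_eq[OF bij_is_inj[OF R.bij]]) (use that in \<open>simp add: \<rho>\<close>)
  \<comment> \<open>Flips the sense of flags with tail in \<open>S\<close>. The next flag has the
    head of \<open>a\<close> as its tail, so the flips before and after a step differ exactly on the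
    cut.\<close>
  define h where "h = (\<lambda>(a, s). (a, s \<noteq> (tail G a \<in> S)))"
  have "h (twisted_succ arev \<rho> {} x) = twisted_succ arev \<pi> (edge_cut G S) (h x)"
    if "x \<in> flags" for x
  proof (cases x)
    case (Pair a s)
    then have "a \<in> arcs G" using that by simp
    then show ?thesis unfolding Pair
      by (auto simp: h_def twisted_succ_def edge_cut_def \<rho> inv_\<rho>)
  qed
  moreover have "inj_on h flags" by (auto simp: inj_on_def h_def)
  ultimately have "card (orbit (twisted_succ arev \<pi> (edge_cut G S)) ` h ` flags) =
      card (orbit (twisted_succ arev \<rho> {}) ` flags)"
    using R.twisted_succ_flags by (intro card_orbits_semiconj)
  moreover have "h ` flags = flags"
  proof -
    have h: "h x \<in> flags" "h (h x) = x" if "x \<in> flags" for x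
      using that by (auto simp: h_def)
    show ?thesis
    proof
      show "h ` flags \<subseteq> flags" using h(1) by (rule image_subsetI)
      show "flags \<subseteq> h ` flags"
      proof
        fix x assume "x \<in> flags"
        from h(2)[OF this, symmetric] h(1)[OF this] show "x \<in> h ` flags" by (rule image_eqI)
      qed
    qed
  qed
  ultimately show ?thesis using R.card_orbits_untwisted by simp
qed

lemma reversal_exists: "\<exists>\<rho>. reversal S \<rho>"
proof -
  define \<rho> where "\<rho> a = (if a \<in> arcs G \<and> tail G a \<in> S then inv \<pi> a else \<pi> a)" for a
  define \<rho>' where "\<rho>' a = (if a \<in> arcs G \<and> tail G a \<in> S then \<pi> a else inv \<pi> a)" for a
  \<comment> \<open>Rotations preserve tails, so \<open>\<rho>\<close> and \<open>\<rho>'\<close>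
    choose matching branches and are mutually inverse.\<close>
  have "bij_betw \<rho> (arcs G) (arcs G)"
    by (rule bij_betw_byWitness[where f' = \<rho>']) (auto simp: \<rho>_def \<rho>'_def)
  moreover have "\<rho> a = a" if "a \<notin> arcs G" for a
    using that permutes by (simp add: \<rho>_def permutes_not_in)
  ultimately have "\<rho> permutes arcs G" by (rule bij_imp_permutes)
  moreover have "cyclic_on \<rho> (out_arcs G v)" if "v \<in> verts G" "out_arcs G v \<noteq> {}" for v
  proof -
    have \<pi>: "cyclic_on \<pi> (out_arcs G v)" using embedding that by (simp add: embedding_def)
    then have inv: "cyclic_on (inv \<pi>) (out_arcs G v)"
      by (simp add: cyclic_on_def orbit_inv_eq[OF permutation])
    show ?thesis
    proof (cases "v \<in> S")
      case True
      then have "cyclic_on \<rho> (out_arcs G v) = cyclic_on (inv \<pi>) (out_arcs G v)"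
        by (intro cyclic_cong) (auto simp: \<rho>_def)
      then show ?thesis using inv by simp
    next
      case False
      then have "cyclic_on \<rho> (out_arcs G v) = cyclic_on \<pi> (out_arcs G v)"
        by (intro cyclic_cong) (auto simp: \<rho>_def)
      then show ?thesis using \<pi> by simp
    qed
  qed
  ultimately have "reversal S \<rho>" by (simp add: reversal_def embedding_def \<rho>_def)
  then show ?thesis by blast
qed

text \<open>At a vertex of degree 3 the only rotation other than that of \<open>\<pi>\<close> is its
  inverse.\<close>

lemma reversal_unstable_vertices:
  assumes "cubic G" and "embedding G \<rho>"
  shows "reversal {v. unstable_vertex G \<pi> \<rho> v} \<rho>"
proof -
  have "\<rho> a = (if unstable_vertex G \<pi> \<rho> (tail G a) then inv \<pi> a else \<pi> a)" if a: "a \<in> arcs G" for a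
  proof (cases "unstable_vertex G \<pi> \<rho> (tail G a)")
    case True
    let ?S = "out_arcs G (tail G a)"
    have 3: "card ?S = 3" using assms(1) a by (auto simp: cubic_def out_degree_def)
    interpret R: embedded_digraph G arev \<rho> by unfold_locales (rule assms(2))
    obtain b where b: "b \<in> ?S" "\<rho> b \<noteq> \<pi> b" using True by (auto simp: unstable_vertex_def)
    have "\<rho> a = \<pi> (\<pi> a)"
      using cyclic_on_card_3_neq[OF cyclic_on_out_arcs[OF a] R.cyclic_on_out_arcs[OF a] 3 b] a
      by simp
    also have "\<dots> = inv \<pi> a"
      using inv_eq_cyclic_on_card_3[OF bij cyclic_on_out_arcs[OF a] 3] a by simp
    finally show ?thesis using True by simp
  next
    case False
    then show ?thesis using a by (auto simp: unstable_vertex_def)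
  qed
  then show ?thesis using assms(2) by (simp add: reversal_def)
qed

text \<open>A 3-cycle differs from its inverse at every point, so each reversal makes the vertex
  unstable.\<close>

lemma unstable_vertex_reversal:
  assumes "cubic G" and "reversal S \<rho>" and a: "a \<in> arcs G"
  shows "unstable_vertex G \<pi> \<rho> (tail G a) \<longleftrightarrow> tail G a \<in> S"
proof -
  have "card (out_arcs G (tail G a)) = 3" using assms(1) a by (auto simp: cubic_def out_degree_def)
  then have "inv \<pi> a \<noteq> \<pi> a"
    using inv_eq_cyclic_on_card_3[OF bij cyclic_on_out_arcs[OF a]]
      cyclic_on_card_3(5)[OF cyclic_on_out_arcs[OF a]] a by simp
  then show ?thesis using assms(2) a by (auto simp: unstable_vertex_def reversal_def)
qed

lemma unstable_arcs_reversal: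
  assumes "cubic G" and "reversal S \<rho>"
  shows "unstable_arcs G \<pi> \<rho> = edge_cut G S"
proof -
  have "unstable_vertex G \<pi> \<rho> (head G a) \<longleftrightarrow> head G a \<in> S" if "a \<in> arcs G" for a
    using unstable_vertex_reversal[OF assms, of "arev a"] that by simp
  then show ?thesis
    using unstable_vertex_reversal[OF assms] by (auto simp: unstable_arcs_def edge_cut_def)
qed

section \<open>Zero-homologous subgraphs of the dual\<close>

text \<open>Double duality: as \<open>arev\<close> is an involution, tracing faces with the dual
  rotation is \<open>\<pi>\<close> again.\<close>

lemma face_of_dual:
  assumes "a \<in> arcs G"
  shows "face_of arev (face_succ arev \<pi>) a = out_arcs G (tail G a)"
proof -
  have "face_succ arev (face_succ arev \<pi>) = \<pi>" by (simp add: face_succ_def fun_eq_iff)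
  then show ?thesis
    using orbit_cyclic_eq3[OF cyclic_on_out_arcs[OF assms]] assms by (simp add: face_of_def)
qed

text \<open>The faces of the dual are the sets of arcs leaving a vertex, so summing their boundaries
  gives the edge cut around a set of vertices.\<close>

lemma zero_homologous_dual_cut:
  assumes "zero_homologous (dual G arev \<pi>) arev (face_succ arev \<pi>) H"
  shows "\<exists>S. arcs H = edge_cut G S"
proof -
  obtain F where F: "F \<subseteq> faces (dual G arev \<pi>) arev (face_succ arev \<pi>)"
    "arcs H = boundary_sum (dual G arev \<pi>) arev F"
    using assms by (auto simp: zero_homologous_def)
  have mem: "a \<in> f \<longleftrightarrow> f = out_arcs G (tail G a)" if "f \<in> F" "a \<in> arcs G" for a f
  proof -
    have "f \<in> face_of arev (face_succ arev \<pi>) ` arcs G" using F(1) that(1) by (auto simp: faces_def dual_def)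
    then obtain b where "b \<in> arcs G" "f = out_arcs G (tail G b)" by (auto simp: face_of_dual)
    then show ?thesis using that(2) by auto
  qed
  have "odd (card {f \<in> F. a \<in> face_boundary (dual G arev \<pi>) arev f}) \<longleftrightarrow>
    (out_arcs G (tail G a) \<in> F) \<noteq> (out_arcs G (head G a) \<in> F)" if a: "a \<in> arcs G" for a
  proof -
    let ?t = "out_arcs G (tail G a)" and ?h = "out_arcs G (head G a)"
    have "a \<in> face_boundary (dual G arev \<pi>) arev f \<longleftrightarrow> (f = ?t) \<noteq> (f = ?h)" if "f \<in> F" for f
      using mem[OF that a] mem[OF that, of "arev a"] a by (simp add: face_boundary_def dual_def)
    then have "{f \<in> F. a \<in> face_boundary (dual G arev \<pi>) arev f} = {f \<in> F. (f = ?t) \<noteq> (f = ?h)}"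
      by blast
    \<comment> \<open>The case \<open>?t = ?h\<close> is that of a loop, which cancels modulo
      2.\<close>
    also have "\<dots> = (if ?t = ?h then {} else {?t, ?h} \<inter> F)" by auto
    finally have "card {f \<in> F. a \<in> face_boundary (dual G arev \<pi>) arev f} =
      (if ?t = ?h then 0 else (if ?t \<in> F then 1 else 0) + (if ?h \<in> F then 1 else 0))" by simp
    then show ?thesis by (simp split: if_splits)
  qed
  then have "arcs H = edge_cut G {v. out_arcs G v \<in> F}"
    unfolding F(2) boundary_sum_def edge_cut_def by (auto simp: dual_def)
  then show ?thesis ..
qed

end

section \<open>The summands of the unstable dual, and the genus count\<close>

text \<open>\<open>union\<close> takes \<open>tail\<close> and \<open>head\<close> from its first
  argument; compatibility with \<open>K\<close> makes those of \<open>H1\<close> and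
  \<open>H2\<close> equal.\<close>

lemma disjoint_union_of_sym:
  assumes "disjoint_union_of K H1 H2"
  shows "disjoint_union_of K H2 H1"
proof -
  have "tail H1 = tail H2" "head H1 = head H2"
    using assms unfolding disjoint_union_of_def subgraph_def compatible_def by metis+
  then have "union H1 H2 = union H2 H1" by (simp add: union_def Un_commute)
  then show ?thesis using assms unfolding disjoint_union_of_def by (metis Int_commute)
qed

text \<open>The arcs determine a summand, because it has no isolated vertices: a face in
  \<open>H1\<close> contains an unstable arc, and that arc cannot belong to \<open>H2\<close>, whose
  faces are disjoint from those of \<open>H1\<close>.\<close>

lemma (in embedded_digraph) unstable_dual_eq_summand:
  assumes "disjoint_union_of (unstable_dual G arev \<pi> \<rho>) H1 H2"
    and "unstable_arcs G \<pi> \<rho>1 = arcs H1"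
  shows "unstable_dual G arev \<pi> \<rho>1 = H1"
proof -
  let ?K = "unstable_dual G arev \<pi> \<rho>"
  have *: "subgraph H1 ?K" "subgraph H2 ?K" "verts H1 \<inter> verts H2 = {}" "?K = union H1 H2"
    using assms(1) by (auto simp: disjoint_union_of_def)
  then have wf: "wf_digraph H1" "wf_digraph H2" by (auto simp: subgraph_def)
  have tail: "tail H1 = face_of arev \<pi>" "tail H2 = face_of arev \<pi>"
    and head: "head H1 = (\<lambda>a. face_of arev \<pi> (arev a))"
    using *(1,2) by (auto simp: subgraph_def compatible_def unstable_dual_def dual_def)
  have arcs: "unstable_arcs G \<pi> \<rho> = arcs H1 \<union> arcs H2"
    and verts: "unstable_faces G arev \<pi> \<rho> = verts H1 \<union> verts H2"
    using arg_cong[OF *(4), of arcs] arg_cong[OF *(4), of verts]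
    by (simp_all add: unstable_dual_def union_def)
  have face: "f = face_of arev \<pi> a" if f: "f \<in> faces G arev \<pi>" "a \<in> f" for a f
  proof -
    obtain b where "f = orbit (face_succ arev \<pi>) b"
      using f(1) unfolding faces_def face_of_def by blast
    then show ?thesis
      using orbit_cyclic_eq3[OF cyclic_on_orbit'[OF permutation_face_succ], of a] f(2)
      by (simp add: face_of_def)
  qed
  have V: "face_of arev \<pi> a \<in> verts H1" if "a \<in> arcs H1" for a
    using wf_digraph.tail_in_verts[OF wf(1) that] tail by simp
  have V2: "face_of arev \<pi> a \<in> verts H2" if "a \<in> arcs H2" for a
    using wf_digraph.tail_in_verts[OF wf(2) that] tail by simp
  have "unstable_faces G arev \<pi> \<rho>1 = verts H1"
  proof (intro set_eqI iffI)
    fix f assume "f \<in> unstable_faces G arev \<pi> \<rho>1"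
    then show "f \<in> verts H1" using assms(2) face V by (fastforce simp: unstable_faces_def)
  next
    fix f assume f: "f \<in> verts H1"
    then have "f \<in> unstable_faces G arev \<pi> \<rho>" using verts by simp
    then obtain a where a: "f \<in> faces G arev \<pi>" "a \<in> f" "a \<in> arcs H1 \<union> arcs H2"
      using arcs by (auto simp: unstable_faces_def)
    \<comment> \<open>The face containing \<open>a\<close> is its dual tail, so \<open>a\<close> in
      \<open>H2\<close> would put \<open>f\<close> into both vertex sets.\<close>
    then have "a \<in> arcs H1" using f face[of f a] V2[of a] *(3) by auto
    then show "f \<in> unstable_faces G arev \<pi> \<rho>1" using a assms(2) by (auto simp: unstable_faces_def)
  qed
  then show ?thesis
    using assms(2) tail head by (simp add: unstable_dual_def dual_def)
qed

theorem proposition4p4: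
  fixes G :: "('v, 'e) pre_digraph"
    and arev \<pi>0 \<pi> :: "'e \<Rightarrow> 'e"
    and H1 H2 :: "('e set, 'e) pre_digraph"
  assumes "fin_digraph G" and "bidirected_digraph G arev" and "connected G" and "cubic G"
    and "embedding G \<pi>0" and "embedding G \<pi>"
    and "disjoint_union_of (unstable_dual G arev \<pi>0 \<pi>) H1 H2"
    and "zero_homologous (dual G arev \<pi>0) arev (face_succ arev \<pi>0) H1"
    and "zero_homologous (dual G arev \<pi>0) arev (face_succ arev \<pi>0) H2"
  shows "\<exists>\<pi>1 \<pi>2. embedding G \<pi>1 \<and> embedding G \<pi>2 \<and>
    unstable_dual G arev \<pi>0 \<pi>1 = H1 \<and> unstable_dual G arev \<pi>0 \<pi>2 = H2 \<and>
    delta_genus G arev \<pi>0 \<pi> = delta_genus G arev \<pi>0 \<pi>1 + delta_genus G arev \<pi>0 \<pi>2"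
proof -
  interpret fin_digraph G by fact
  interpret bidirected_digraph G arev by fact
  interpret embedded_digraph G arev \<pi>0 by unfold_locales fact
  define U where "U = {v. unstable_vertex G \<pi>0 \<pi> v}"
  have U: "reversal U \<pi>" unfolding U_def using assms(4,6) by (rule reversal_unstable_vertices)
  obtain S1 S2 where S: "arcs H1 = edge_cut G S1" "arcs H2 = edge_cut G S2"
    using zero_homologous_dual_cut assms(8,9) by meson
  obtain \<pi>1 \<pi>2 where R: "reversal S1 \<pi>1" "reversal S2 \<pi>2"
    using reversal_exists by meson
  have H1: "unstable_dual G arev \<pi>0 \<pi>1 = H1"
    using assms(7) by (rule unstable_dual_eq_summand) (simp add: S unstable_arcs_reversal[OF assms(4)] R)
  have H2: "unstable_dual G arev \<pi>0 \<pi>2 = H2"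
    using disjoint_union_of_sym[OF assms(7)]
    by (rule unstable_dual_eq_summand) (simp add: S unstable_arcs_reversal[OF assms(4)] R)
  \<comment> \<open>Only the cuts are compared, since the orbit counts depend on nothing else;
    \<open>U\<close>, \<open>S1\<close> and \<open>S2\<close> are not related as vertex
    sets.\<close>
  have cut: "edge_cut G U = edge_cut G S1 \<union> edge_cut G S2"
    using assms(7) S unstable_arcs_reversal[OF assms(4) U]
    by (auto simp: disjoint_union_of_def unstable_dual_def union_def)
  have wf: "wf_digraph H1" "wf_digraph H2" and disj: "verts H1 \<inter> verts H2 = {}"
    using assms(7) by (auto simp: disjoint_union_of_def subgraph_def)
  have ends: "tail H a = face_of arev \<pi>0 a" "head H a = face_of arev \<pi>0 (arev a)"
    if "H = H1 \<or> H = H2" for H a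
    using H1 H2 that by (auto simp: unstable_dual_def dual_def)
  have in1: "face_of arev \<pi>0 a \<in> verts H1 \<and> face_of arev \<pi>0 (arev a) \<in> verts H1"
    if "a \<in> edge_cut G S1" for a
    using wf_digraph.wellformed[OF wf(1), of a] that S ends by simp
  have in2: "face_of arev \<pi>0 a \<notin> verts H1 \<and> face_of arev \<pi>0 (arev a) \<notin> verts H1"
    if "a \<in> edge_cut G S2" for a
    using wf_digraph.wellformed[OF wf(2), of a] that S ends disj by auto
  \<comment> \<open>The set \<open>V\<close> is \<open>verts H1\<close> here, and the factor 2 from
    the two directions cancels.\<close>
  have "card (faces G arev \<pi>) + card (faces G arev \<pi>0) =
      card (faces G arev \<pi>1) + card (faces G arev \<pi>2)"
    using card_orbits_twisted_additive[OF cut in1 in2] card_orbits_untwisted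
      card_orbits_reversal[OF U] card_orbits_reversal[OF R(1)] card_orbits_reversal[OF R(2)] by simp
  then have "(of_nat (card (faces G arev \<pi>)) :: rat) + of_nat (card (faces G arev \<pi>0)) =
      of_nat (card (faces G arev \<pi>1)) + of_nat (card (faces G arev \<pi>2))"
    by (metis of_nat_add)
  \<comment> \<open>Vertex and edge counts cancel, so each genus difference is half the loss in
    faces.\<close>
  then have "delta_genus G arev \<pi>0 \<pi> = delta_genus G arev \<pi>0 \<pi>1 + delta_genus G arev \<pi>0 \<pi>2"
    unfolding delta_genus_def genus_def by (simp add: field_simps)
  then show ?thesis using R H1 H2 by (auto simp: reversal_def)
qed

end
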